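(* Let $(V,\|\cdot\|)$ be a normed plane. Then Birkhoff orthogonality is a symmetric relation in $(V,\|\cdot\|)$ (that is, $x\dashv_B y$ implies $y\dashv_B x$ for all $x,y\in V$) if and only if the unit circle $S=\{x\in V:\|x\|=1\}$ is a Radon curve.
   Context: A normed plane is a two-dimensional real vector space $V$ with a norm $\|\cdot\|$. A vector $x$ is Birkhoff orthogonal to $y$, written $x\dashv_B y$, if $\|x\|\le\|x+ty\|$ for every $t\in\mathbb{R}$. The origin is denoted $o$. A convex body is a compact convex set with interior points. Radon curves. A curve $\gamma\subset V$ is a Radon curve if it arises from the following construction. Take linearly independent $v,w\in V$ and the non-degenerate symplectic bilinear form $[\cdot,\cdot]$ on $V$ with $[v,w]=1$. Let $\gamma_1$ be a curve connecting $v$ and $w$, with $\gamma_1\subseteq\mathrm{conv}\{o,v,w,v+w\}$, such that the union of $\gamma_1$ with the segments from $o$ to $v$ and from $o$ to $w$ is the boundary of a convex body. Let $\gamma_2$ be the curve $$\gamma_2(\lambda)=\frac{(1-\lambda)w+\lambda(-v)}{\sup_{x\in\gamma_1}|[x,(1-\lambda)w+\lambda(-v)]|},\qquad \lambda\in[0,1].$$ Then $\gamma=\gamma_1\cup\gamma_2\cup(-\gamma_1)\cup(-\gamma_2)$. *)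

theory Defs
  imports "HOL-Analysis.Analysis"
begin

definition birkhoff_orthogonal :: "'a::real_normed_vector \<Rightarrow> 'a \<Rightarrow> bool" (infix "\<stileturn>\<^sub>B" 50)
  where "x \<stileturn>\<^sub>B y \<longleftrightarrow> (\<forall>t::real. norm x \<le> norm (x + t *\<^sub>R y))"

definition symplectic_form :: "('a::real_vector \<Rightarrow> 'a \<Rightarrow> real) \<Rightarrow> bool"
  where "symplectic_form \<omega> \<longleftrightarrow>
    bilinear \<omega> \<and> (\<forall>x. \<omega> x x = 0) \<and> (\<forall>x. (\<forall>y. \<omega> x y = 0) \<longrightarrow> x = 0)"

definition convex_body :: "'a::real_normed_vector set \<Rightarrow> bool"
  where "convex_body K \<longleftrightarrow> compact K \<and> convex K \<and> interior K \<noteq> {}"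

definition radon_gamma2 ::
    "('a::real_vector \<Rightarrow> 'a \<Rightarrow> real) \<Rightarrow> 'a \<Rightarrow> 'a \<Rightarrow> 'a set \<Rightarrow> real \<Rightarrow> 'a"
  where "radon_gamma2 \<omega> v w \<gamma>\<^sub>1 l =
    (let y = (1 - l) *\<^sub>R w + l *\<^sub>R (- v)
     in (1 / (SUP x\<in>\<gamma>\<^sub>1. \<bar>\<omega> x y\<bar>)) *\<^sub>R y)"

text \<open>
  Curves are identified with their point sets. The curve from \<open>v\<close> to \<open>w\<close> is the image of an
  injective path (\<open>arc\<close>): a path allowed to retrace itself could additionally cover part of the
  segments from the origin without changing the boundary condition, and would then
  add spurious spikes to the curve.
  In a plane, \<open>\<omega>\<close> is uniquely determined by \<open>v\<close> and \<open>w\<close>.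
\<close>

definition radon_curve :: "'a::real_normed_vector set \<Rightarrow> bool"
  where "radon_curve \<gamma> \<longleftrightarrow>
    (\<exists>v w \<omega> \<gamma>\<^sub>1 \<gamma>\<^sub>2.
      v \<noteq> w \<and> independent {v, w} \<and>
      symplectic_form \<omega> \<and> \<omega> v w = 1 \<and>
      (\<exists>g. arc g \<and> pathstart g = v \<and> pathfinish g = w \<and> path_image g = \<gamma>\<^sub>1) \<and>
      \<gamma>\<^sub>1 \<subseteq> convex hull {0, v, w, v + w} \<and>
      (\<exists>K. convex_body K \<and> \<gamma>\<^sub>1 \<union> closed_segment 0 v \<union> closed_segment 0 w = frontier K) \<and>
      \<gamma>\<^sub>2 = radon_gamma2 \<omega> v w \<gamma>\<^sub>1 ` {0..1} \<and>
      \<gamma> = \<gamma>\<^sub>1 \<union> \<gamma>\<^sub>2 \<union> uminus ` \<gamma>\<^sub>1 \<union> uminus ` \<gamma>\<^sub>2)"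

end

theory Submission
  imports Defs
begin

text \<open>
  In the frame \<open>v, w\<close> write \<open>N\<^sup>* y\<close> for the supremum of \<open>\<bar>\<omega> x y\<bar>\<close> over the unit circle. Then
  \<open>x \<stileturn>\<^sub>B y\<close> means \<open>\<bar>\<omega> x y\<bar> = \<parallel>x\<parallel> N\<^sup>* y\<close>, so orthogonality is symmetric as soon as \<open>N\<^sup>*\<close> is the norm.
  If the unit circle is a Radon curve, this holds on the second quadrant by construction, and on the
  first by biduality. Conversely, if orthogonality is symmetric and \<open>v\<close>, \<open>w\<close> are orthogonal unit
  vectors with \<open>\<omega> v w = 1\<close>, then \<open>\<omega> x y = 1\<close> for all orthogonal unit vectors \<open>x\<close> in the first and
  \<open>y\<close> in the second quadrant: when the pair moves, this area changes only by products of increments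
  of \<open>x\<close> and \<open>y\<close>, and both move monotonically. Hence the second quadrant of the circle is \<open>\<gamma>\<^sub>2\<close>.
\<close>

section \<open>A constancy criterion and the existence of Birkhoff orthogonal directions\<close>

text \<open>Over a partition of the interval into \<open>n\<close> equal pieces the bounds telescope
  in \<open>Y\<close>, so the total change of \<open>h\<close> is at most
  \<open>C * (b - a) / n * (Y b - Y a)\<close>, which tends to 0.\<close>

lemma constant_if_increments_le_mono:
  fixes h Y :: "real \<Rightarrow> real"
  assumes inc: "\<And>s t. a \<le> s \<Longrightarrow> s \<le> t \<Longrightarrow> t \<le> b \<Longrightarrow> \<bar>h t - h s\<bar> \<le> C * (t - s) * (Y t - Y s)"
    and ab: "a \<le> b"
  shows "h b = h a"
proof -
  have bound: "\<bar>h b - h a\<bar> \<le> (C * (b - a) * (Y b - Y a)) / real n" if n: "n > 0" for n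
  proof -
    define p where "p i = a + (b - a) * real i / real n" for i
    have p0: "p 0 = a" and pn: "p n = b" using n by (auto simp: p_def)
    have step: "p (Suc i) - p i = (b - a) / n" for i
      by (simp add: p_def diff_divide_distrib[symmetric] distrib_left)
    have pmono: "p i \<le> p (Suc i)" for i
      using step[of i] ab by (smt (verit) divide_nonneg_nonneg of_nat_0_le_iff)
    have pa: "a \<le> p i" for i using ab by (simp add: p_def)
    have pb: "p i \<le> b" if "i \<le> n" for i
    proof -
      have "(b - a) * real i \<le> (b - a) * real n" using that ab by (intro mult_left_mono) auto
      then show ?thesis using n by (simp add: p_def field_simps)
    qed
    have "\<bar>h b - h a\<bar> = \<bar>\<Sum>i<n. h (p (Suc i)) - h (p i)\<bar>"
      using sum_lessThan_telescope[of "\<lambda>i. h (p i)" n] by (simp add: p0 pn)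
    also have "\<dots> \<le> (\<Sum>i<n. \<bar>h (p (Suc i)) - h (p i)\<bar>)" by (rule sum_abs)
    also have "\<dots> \<le> (\<Sum>i<n. C * ((b - a) / n) * (Y (p (Suc i)) - Y (p i)))"
      by (rule sum_mono) (metis inc step pmono pa pb Suc_leI lessThan_iff)
    also have "\<dots> = C * ((b - a) / n) * (Y b - Y a)"
      unfolding sum_distrib_left[symmetric]
      using sum_lessThan_telescope[of "\<lambda>i. Y (p i)" n] by (simp add: p0 pn)
    finally show ?thesis by simp
  qed
  have "(\<lambda>n. (C * (b - a) * (Y b - Y a)) / real n) \<longlonglongrightarrow> 0"
    by (rule lim_const_over_n)
  then have "\<bar>h b - h a\<bar> \<le> 0"
    using bound by (intro LIMSEQ_le_const) (auto intro!: exI[of _ 1])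
  then show ?thesis by simp
qed

text \<open>A point of minimal norm on the line through \<open>e\<close> in direction
  \<open>w\<close> is orthogonal to \<open>w\<close>; coercivity of the norm reduces its existence
  to a compact interval.\<close>

lemma birkhoff_orthogonal_exists_left:
  fixes e w :: "'a::real_normed_vector"
  assumes w: "w \<noteq> 0"
  obtains t where "(e + t *\<^sub>R w) \<stileturn>\<^sub>B w"
proof -
  \<comment> \<open>Beyond this radius \<open>s *\<^sub>R w\<close> has norm at least
    \<open>2 * norm e\<close>, so \<open>e + s *\<^sub>R w\<close> is no shorter than
    \<open>e\<close>, its value at \<open>s = 0\<close>.\<close>
  define R where "R = 2 * norm e / norm w"
  have R0: "R \<ge> 0" by (simp add: R_def)
  have "\<exists>t\<in>{-R..R}. \<forall>s\<in>{-R..R}. norm (e + t *\<^sub>R w) \<le> norm (e + s *\<^sub>R w)"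
    using R0 by (intro continuous_attains_inf) (auto intro!: continuous_intros)
  then obtain t where t: "\<And>s. s \<in> {-R..R} \<Longrightarrow> norm (e + t *\<^sub>R w) \<le> norm (e + s *\<^sub>R w)"
    by blast
  have all: "norm (e + t *\<^sub>R w) \<le> norm (e + s *\<^sub>R w)" for s
  proof (cases "s \<in> {-R..R}")
    case False
    then have "R \<le> \<bar>s\<bar>" by auto
    then have "2 * norm e \<le> \<bar>s\<bar> * norm w" using w by (simp add: R_def field_simps)
    moreover have "norm (s *\<^sub>R w) \<le> norm (e + s *\<^sub>R w) + norm e"
      by (metis add.commute add_diff_cancel norm_triangle_ineq4)
    ultimately have "norm e \<le> norm (e + s *\<^sub>R w)" by simp
    then show ?thesis using t[of 0] R0 by simp
  qed (rule t)
  have "(e + t *\<^sub>R w) \<stileturn>\<^sub>B w"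
    unfolding birkhoff_orthogonal_def
    using all by (metis add.assoc scaleR_left_distrib)
  then show thesis by (rule that)
qed

text \<open>A one-step Hahn--Banach extension: the infimum \<open>c\<close> is the value at \<open>e\<close> of a norming
  functional of \<open>y\<close>, and the orthogonal direction spans its kernel.\<close>

lemma birkhoff_orthogonal_exists_right:
  fixes e y :: "'a::real_normed_vector"
  assumes y: "y \<noteq> 0"
  obtains c where "y \<stileturn>\<^sub>B (norm y *\<^sub>R e - c *\<^sub>R y)"
proof -
  let ?F = "\<lambda>s. norm (e + s *\<^sub>R y) - s * norm y"
  define c where "c = (INF s. ?F s)"
  have le: "s * norm y - norm (s *\<^sub>R y - e) \<le> ?F s'" for s s'
  proof -
    have "(s + s') * norm y \<le> norm ((s + s') *\<^sub>R y)" by (simp add: mult_right_mono)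
    also have "\<dots> = norm ((s *\<^sub>R y - e) + (e + s' *\<^sub>R y))" by (simp add: algebra_simps)
    also have "\<dots> \<le> norm (s *\<^sub>R y - e) + norm (e + s' *\<^sub>R y)" by (rule norm_triangle_ineq)
    finally show ?thesis by (simp add: algebra_simps)
  qed
  have up: "c \<le> ?F s" for s
    unfolding c_def using le[of 0] by (intro cINF_lower bdd_belowI2) auto
  have lo: "s * norm y - norm (s *\<^sub>R y - e) \<le> c" for s
    unfolding c_def using le[of s] by (intro cINF_greatest) auto
  \<comment> \<open>The functional with values \<open>norm y\<close> at \<open>y\<close> and
    \<open>c\<close> at \<open>e\<close> is dominated by the norm: positive \<open>r\<close>
    rescales \<open>up\<close>, negative \<open>r\<close> rescales \<open>lo\<close>.\<close>
  have dom: "s * norm y + r * c \<le> norm (s *\<^sub>R y + r *\<^sub>R e)" for s r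
  proof (cases r "0::real" rule: linorder_cases)
    case equal
    then show ?thesis by (simp add: mult_right_mono)
  next
    case greater
    have "r * c \<le> r * ?F (s / r)" using greater up[of "s / r"] by (intro mult_left_mono) auto
    also have "\<dots> = norm (r *\<^sub>R (e + (s / r) *\<^sub>R y)) - s * norm y"
      using greater by (simp add: right_diff_distrib)
    also have "r *\<^sub>R (e + (s / r) *\<^sub>R y) = s *\<^sub>R y + r *\<^sub>R e"
      using greater by (simp add: scaleR_add_right)
    finally show ?thesis by simp
  next
    case less
    define q where "q = - r"
    have q: "q > 0" using less by (simp add: q_def)
    have "q * (s / q * norm y - norm ((s / q) *\<^sub>R y - e)) \<le> q * c"
      using q by (intro mult_left_mono lo) auto
    moreover have "q * (s / q * norm y - norm ((s / q) *\<^sub>R y - e))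
        = s * norm y - norm (q *\<^sub>R ((s / q) *\<^sub>R y - e))"
      using q by (simp add: right_diff_distrib)
    moreover have "q *\<^sub>R ((s / q) *\<^sub>R y - e) = s *\<^sub>R y + r *\<^sub>R e"
      using q by (simp add: scaleR_diff_right q_def)
    ultimately have "s * norm y - norm (s *\<^sub>R y + r *\<^sub>R e) \<le> q * c" by simp
    then show ?thesis by (simp add: q_def)
  qed
  have "y \<stileturn>\<^sub>B (norm y *\<^sub>R e - c *\<^sub>R y)"
    unfolding birkhoff_orthogonal_def
  proof
    fix t
    have "norm y = (1 - t * c) * norm y + (t * norm y) * c" by (simp add: algebra_simps)
    also have "\<dots> \<le> norm ((1 - t * c) *\<^sub>R y + (t * norm y) *\<^sub>R e)" by (rule dom)
    also have "(1 - t * c) *\<^sub>R y + (t * norm y) *\<^sub>R e = y + t *\<^sub>R (norm y *\<^sub>R e - c *\<^sub>R y)"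
      by (simp add: algebra_simps)
    finally show "norm y \<le> norm (y + t *\<^sub>R (norm y *\<^sub>R e - c *\<^sub>R y))" .
  qed
  then show thesis by (rule that)
qed

section \<open>Bases and symplectic forms of the plane\<close>

lemma span_pair_eq_UNIV:
  fixes v w :: "'a::real_vector"
  assumes dim: "dim (UNIV :: 'a set) = 2" and ind: "independent {v, w}" and ne: "v \<noteq> w"
  shows "span {v, w} = UNIV"
proof -
  obtain B :: "'a set" where B: "independent B" "span B = UNIV" "card B = 2"
    using dim basis_exists[of "UNIV :: 'a set"] by (metis top.extremum_uniqueI)
  then have fin: "finite B" by (metis card.infinite zero_neq_numeral)
  have "x \<in> span {v, w}" for x
  proof (rule ccontr)
    assume x: "x \<notin> span {v, w}"
    then have "independent (insert x {v, w})" using ind by (rule independent_insertI)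
    then have "card (insert x {v, w}) \<le> 2"
      using independent_span_bound[OF fin] B by auto
    moreover have "x \<notin> {v, w}" using x span_base[of x "{v, w}"] by blast
    ultimately show False using ne by simp
  qed
  then show ?thesis by auto
qed

text \<open>The form is the determinant in the coordinates \<open>A\<close>, \<open>B\<close> dual
  to the basis; pairing with \<open>w\<close> and \<open>v\<close> recovers these coordinates,
  whence non-degeneracy.\<close>

lemma symplectic_form_exists:
  fixes v w :: "'a::real_vector"
  assumes ind: "independent {v, w}" and ne: "v \<noteq> w" and sp: "span {v, w} = UNIV"
  obtains \<omega> where "symplectic_form \<omega>" "\<omega> v w = 1"
proof -
  obtain A :: "'a \<Rightarrow> real" where A: "linear A" "A v = 1" "A w = 0"
    using linear_independent_extend[OF ind, of "\<lambda>x. if x = v then 1 else (0::real)"] ne by auto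
  obtain B :: "'a \<Rightarrow> real" where B: "linear B" "B v = 0" "B w = 1"
    using linear_independent_extend[OF ind, of "\<lambda>x. if x = v then 0 else (1::real)"] ne by auto
  define \<omega> where "\<omega> x y = A x * B y - B x * A y" for x y
  have bil: "bilinear \<omega>"
    unfolding bilinear_def \<omega>_def
    by (intro conjI allI linearI;
        simp add: linear_add[OF A(1)] linear_add[OF B(1)] linear_scale[OF A(1)] linear_scale[OF B(1)]
          algebra_simps)
  have lin: "linear (\<lambda>x. A x *\<^sub>R v + B x *\<^sub>R w)"
    by (intro linearI;
        simp add: linear_add[OF A(1)] linear_add[OF B(1)] linear_scale[OF A(1)] linear_scale[OF B(1)]
          algebra_simps)
  have ex: "x = A x *\<^sub>R v + B x *\<^sub>R w" for x
    by (rule linear_eq_on_span[OF linear_ident lin, of "{v, w}"]) (auto simp: A B sp)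
  have nd: "x = 0" if "\<forall>y. \<omega> x y = 0" for x
  proof -
    have "A x = 0" "B x = 0" using that[rule_format, of w] that[rule_format, of v]
      by (auto simp: \<omega>_def A B)
    then show ?thesis using ex[of x] by simp
  qed
  show thesis
    by (rule that[of \<omega>]) (use bil nd in \<open>auto simp: symplectic_form_def \<omega>_def A B\<close>)
qed

section \<open>Birkhoff orthogonality in symplectic coordinates\<close>

text \<open>\<open>expand\<close> is Cramer's rule. It encodes that \<open>v\<close>,
  \<open>w\<close> span the plane and makes \<open>\<omega> x w\<close> and
  \<open>\<omega> v x\<close> the coordinates of \<open>x\<close>.\<close>

locale symplectic_frame =
  fixes \<omega> :: "'a::real_normed_vector \<Rightarrow> 'a \<Rightarrow> real" and v w :: 'a
  assumes symplectic: "symplectic_form \<omega>"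
    and \<omega>_vw: "\<omega> v w = 1"
    and expand: "\<And>x. x = \<omega> x w *\<^sub>R v + \<omega> v x *\<^sub>R w"
begin

lemma bilinear: "bilinear \<omega>" and \<omega>_self [simp]: "\<omega> x x = 0"
  using symplectic by (auto simp: symplectic_form_def)

lemmas \<omega>_simps [simp] =
  bilinear_ladd[OF bilinear] bilinear_radd[OF bilinear] bilinear_lmul[OF bilinear]
  bilinear_rmul[OF bilinear] bilinear_lneg[OF bilinear] bilinear_rneg[OF bilinear]
  bilinear_lzero[OF bilinear] bilinear_rzero[OF bilinear]
  bilinear_lsub[OF bilinear] bilinear_rsub[OF bilinear]

lemma \<omega>_flip: "\<omega> y x = - \<omega> x y"
proof -
  have "\<omega> x x + \<omega> x y + (\<omega> y x + \<omega> y y) = \<omega> (x + y) (x + y)" by (simp del: \<omega>_self)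
  then show ?thesis by simp
qed

lemma \<omega>_wv: "\<omega> w v = - 1"
  using \<omega>_flip[of w v] \<omega>_vw by simp

lemma \<omega>_coord: "\<omega> x y = \<omega> x w * \<omega> v y - \<omega> v x * \<omega> y w"
proof -
  have "\<omega> x y = \<omega> x (\<omega> y w *\<^sub>R v + \<omega> v y *\<^sub>R w)" using expand[of y] by simp
  also have "\<dots> = \<omega> y w * \<omega> x v + \<omega> v y * \<omega> x w" by simp
  finally show ?thesis using \<omega>_flip[of x v] by simp
qed

lemma coord_eqI: "\<omega> x w = \<omega> y w \<Longrightarrow> \<omega> v x = \<omega> v y \<Longrightarrow> x = y"
  using expand[of x] expand[of y] by simp

lemma \<omega>_eq_0_parallel:
  assumes "\<omega> u y = 0" "y \<noteq> 0"
  obtains t where "u = t *\<^sub>R y"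
proof -
  have eq: "\<omega> u w * \<omega> v y = \<omega> v u * \<omega> y w" using assms(1) \<omega>_coord[of u y] by simp
  show thesis
  proof (cases "\<omega> y w = 0")
    case True
    then have nz: "\<omega> v y \<noteq> 0" using assms(2) expand[of y] by auto
    then have "u = (\<omega> v u / \<omega> v y) *\<^sub>R y" using eq True by (intro coord_eqI) auto
    then show thesis by (rule that)
  next
    case False
    then have "u = (\<omega> u w / \<omega> y w) *\<^sub>R y" using eq by (intro coord_eqI) (auto simp: field_simps)
    then show thesis by (rule that)
  qed
qed

text \<open>The line through \<open>x\<close> parallel to \<open>y\<close> is a level line of
  \<open>\<omega> _ y\<close>, so \<open>x\<close> is shortest on it exactly when this functional
  attains its dual norm in the direction of \<open>x\<close>. The inequality is multiplied out to
  include zero vectors.\<close>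

lemma birkhoff_orthogonal_iff:
  "x \<stileturn>\<^sub>B y \<longleftrightarrow> (\<forall>z. norm x * \<bar>\<omega> z y\<bar> \<le> norm z * \<bar>\<omega> x y\<bar>)"
proof
  assume orth: "x \<stileturn>\<^sub>B y"
  show "\<forall>z. norm x * \<bar>\<omega> z y\<bar> \<le> norm z * \<bar>\<omega> x y\<bar>"
  proof
    fix z
    show "norm x * \<bar>\<omega> z y\<bar> \<le> norm z * \<bar>\<omega> x y\<bar>"
    proof (cases "\<omega> z y = 0")
      case False
      \<comment> \<open>This factor moves \<open>z\<close> onto the line through \<open>x\<close>
        parallel to \<open>y\<close>, where no vector is shorter than \<open>x\<close>.\<close>
      define c where "c = \<omega> x y / \<omega> z y"
      have y0: "y \<noteq> 0" using False by auto
      have "\<omega> (x - c *\<^sub>R z) y = 0" using False by (simp add: c_def)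
      then obtain t where t: "x - c *\<^sub>R z = t *\<^sub>R y" using \<omega>_eq_0_parallel y0 by metis
      have "norm x \<le> norm (x + (- t) *\<^sub>R y)" using orth unfolding birkhoff_orthogonal_def by blast
      also have "x + (- t) *\<^sub>R y = c *\<^sub>R z" using t by (simp add: algebra_simps)
      also have "norm (c *\<^sub>R z) = \<bar>\<omega> x y\<bar> / \<bar>\<omega> z y\<bar> * norm z" by (simp add: c_def)
      finally show ?thesis using False by (simp add: field_simps)
    qed auto
  qed
next
  assume dom: "\<forall>z. norm x * \<bar>\<omega> z y\<bar> \<le> norm z * \<bar>\<omega> x y\<bar>"
  show "x \<stileturn>\<^sub>B y"
  proof (cases "\<omega> x y = 0")
    case True
    then have z: "norm x * \<bar>\<omega> z y\<bar> = 0" for z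
      using dom[rule_format, of z] by (intro antisym) auto
    have "x = 0 \<or> y = 0"
    proof (cases "x = 0")
      case False
      then have "\<omega> z y = 0" for z using z[of z] by simp
      then have "y = 0" using coord_eqI[of y 0] \<omega>_flip[of w y] by simp
      then show ?thesis ..
    qed auto
    then show ?thesis unfolding birkhoff_orthogonal_def by auto
  next
    case False
    show ?thesis unfolding birkhoff_orthogonal_def
    proof
      fix t
      have "norm x * \<bar>\<omega> x y\<bar> \<le> norm (x + t *\<^sub>R y) * \<bar>\<omega> x y\<bar>"
        using dom[rule_format, of "x + t *\<^sub>R y"] by simp
      then show "norm x \<le> norm (x + t *\<^sub>R y)" using False by simp
    qed
  qed
qed

text \<open>The Pluecker relation between the areas spanned by four vectors of the plane. It later
  turns maximality of areas into an ordering of directions.\<close>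

lemma pluecker: "\<omega> x' y * \<omega> x y' = \<omega> y' y * \<omega> x x' + \<omega> x' y' * \<omega> x y"
  unfolding \<omega>_coord[of x' y] \<omega>_coord[of x y'] \<omega>_coord[of y' y] \<omega>_coord[of x x']
    \<omega>_coord[of x' y'] \<omega>_coord[of x y]
  by algebra

end

lemma symplectic_frameI:
  fixes v w :: "'a::real_normed_vector"
  assumes symp: "symplectic_form \<omega>" and one: "\<omega> v w = 1" and sp: "span {v, w} = UNIV"
  shows "symplectic_frame \<omega> v w"
proof
  have bil: "bilinear \<omega>" and self: "\<And>x. \<omega> x x = 0"
    using symp by (auto simp: symplectic_form_def)
  have lin: "linear (\<lambda>x. \<omega> x w *\<^sub>R v + \<omega> v x *\<^sub>R w)"
    by (intro linearI; simp add: bilinear_ladd[OF bil] bilinear_radd[OF bil]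
        bilinear_lmul[OF bil] bilinear_rmul[OF bil] algebra_simps)
  show "x = \<omega> x w *\<^sub>R v + \<omega> v x *\<^sub>R w" for x
    by (rule linear_eq_on_span[OF linear_ident lin, of "{v, w}"]) (auto simp: self one sp)
qed (use assms in auto)

lemma diff_abs_le_max:
  fixes X Y :: real
  assumes "0 \<le> X * Y"
  shows "\<bar>X - Y\<bar> \<le> max \<bar>X\<bar> \<bar>Y\<bar>"
  using assms by (auto simp: zero_le_mult_iff max_def)

section \<open>Unit frames and the quarter of the unit circle\<close>

text \<open>The coordinate bounds say that the unit vectors \<open>v\<close> and \<open>w\<close>
  are Birkhoff orthogonal to each other in both orders: the unit ball lies in the parallelogram with
  coordinates in [-1, 1].\<close>

locale unit_frame = symplectic_frame +
  assumes norm_v: "norm v = 1" and norm_w: "norm w = 1"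
    and coord_v_le: "\<And>x. \<bar>\<omega> x w\<bar> \<le> norm x"
    and coord_w_le: "\<And>x. \<bar>\<omega> v x\<bar> \<le> norm x"
begin

text \<open>This symmetry carries every statement about the first quadrant over to the
  second.\<close>

lemma rotated: "unit_frame \<omega> w (- v)"
proof
  show "x = \<omega> x (- v) *\<^sub>R w + \<omega> w x *\<^sub>R - v" for x
    using expand[of x] \<omega>_flip[of x v] \<omega>_flip[of w x] by (simp add: add.commute)
  show "\<bar>\<omega> x (- v)\<bar> \<le> norm x" for x using coord_w_le[of x] \<omega>_flip[of x v] by simp
  show "\<bar>\<omega> w x\<bar> \<le> norm x" for x using coord_v_le[of x] \<omega>_flip[of x w] by simp
qed (use symplectic \<omega>_wv norm_v norm_w in auto)

lemma continuous_on_coord_v [continuous_intros]: "continuous_on S (\<lambda>x. \<omega> x w)"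
  by (intro linear_continuous_on bounded_linear_intro[where K = 1]) (auto simp: coord_v_le)

lemma continuous_on_coord_w [continuous_intros]: "continuous_on S (\<lambda>x. \<omega> v x)"
  by (intro linear_continuous_on bounded_linear_intro[where K = 1]) (auto simp: coord_w_le)

lemma continuous_on_\<omega>_left: "continuous_on S (\<lambda>x. \<omega> x y)"
proof -
  have eq: "(\<lambda>x. \<omega> x y) = (\<lambda>x. \<omega> x w * \<omega> v y - \<omega> v x * \<omega> y w)"
    by (rule ext) (rule \<omega>_coord)
  show ?thesis unfolding eq by (intro continuous_intros)
qed

definition quarter :: "'a set"
  where "quarter = {x. norm x = 1 \<and> 0 \<le> \<omega> x w \<and> 0 \<le> \<omega> v x}"

definition chord :: "real \<Rightarrow> 'a"
  where "chord t = (1 - t) *\<^sub>R v + t *\<^sub>R w"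

text \<open>Radial projection of the chord keeps the parametrization Lipschitz, and in the frame
  \<open>w\<close>, \<open>- v\<close> it has the shape of \<open>radon_gamma2\<close> with the
  supremum replaced by the norm.\<close>

definition quarter_path :: "real \<Rightarrow> 'a"
  where "quarter_path t = (1 / norm (chord t)) *\<^sub>R chord t"

lemma chord_coords [simp]: "\<omega> (chord t) w = 1 - t" "\<omega> v (chord t) = t"
  by (auto simp: chord_def \<omega>_vw)

text \<open>The two coordinates of a chord point add up to 1, so one of them is at least
  1/2.\<close>

lemma norm_chord_ge: "1 / 2 \<le> norm (chord t)"
  using coord_v_le[of "chord t"] coord_w_le[of "chord t"] by simp

lemma norm_chord_pos: "0 < norm (chord t)"
  using norm_chord_ge[of t] by linarith

lemma chord_nonzero [simp]: "chord t \<noteq> 0"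
  using norm_chord_pos[of t] by auto

lemma quarter_path_coords:
  "\<omega> (quarter_path t) w = (1 - t) / norm (chord t)" "\<omega> v (quarter_path t) = t / norm (chord t)"
  by (auto simp: quarter_path_def)

lemma norm_quarter_path: "norm (quarter_path t) = 1"
  by (simp add: quarter_path_def)

lemma quarter_path_image: "quarter_path ` {0..1} = quarter"
proof (intro equalityI subsetI)
  fix x assume "x \<in> quarter"
  then have x: "norm x = 1" "0 \<le> \<omega> x w" "0 \<le> \<omega> v x" by (auto simp: quarter_def)
  define s where "s = \<omega> x w + \<omega> v x"
  have "s \<noteq> 0"
  proof
    assume "s = 0"
    then have "\<omega> x w = 0" "\<omega> v x = 0" using x by (auto simp: s_def)
    then show False using x(1) expand[of x] by auto
  qed
  then have s: "s > 0" using x by (auto simp: s_def)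
  have ch: "chord (\<omega> v x / s) = (1 / s) *\<^sub>R x"
    by (rule coord_eqI) (use s in \<open>auto simp: field_simps s_def\<close>)
  have "x = quarter_path (\<omega> v x / s)"
    unfolding quarter_path_def ch using s x by simp
  moreover have "\<omega> v x / s \<in> {0..1}" using s x by (auto simp: s_def)
  ultimately show "x \<in> quarter_path ` {0..1}" by blast
qed (auto simp: quarter_def quarter_path_coords norm_quarter_path)

lemma continuous_quarter_path: "continuous_on S quarter_path"
proof -
  have "continuous_on S chord" unfolding chord_def[abs_def] by (intro continuous_intros)
  then show ?thesis unfolding quarter_path_def by (intro continuous_intros) auto
qed

lemma arc_quarter_path: "arc quarter_path"
proof -
  have "t = s" if eq: "quarter_path t = quarter_path s" for t s
  proof -
    have "(1 - t) / norm (chord t) = (1 - s) / norm (chord s)" "t / norm (chord t) = s / norm (chord s)"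
      using quarter_path_coords eq by metis+
    then have "1 / norm (chord t) = 1 / norm (chord s)" by (simp add: diff_divide_distrib)
    then show ?thesis using \<open>t / norm (chord t) = s / norm (chord s)\<close> by simp
  qed
  then show ?thesis
    unfolding arc_def path_def inj_on_def using continuous_quarter_path by blast
qed

lemma quarter_path_0: "quarter_path 0 = v" and quarter_path_1: "quarter_path 1 = w"
  by (auto simp: quarter_path_def chord_def norm_v norm_w)

lemma compact_quarter: "compact quarter"
  unfolding quarter_path_image[symmetric]
  by (intro compact_continuous_image continuous_quarter_path) auto

lemma v_in_quarter: "v \<in> quarter" and w_in_quarter: "w \<in> quarter"
  by (auto simp: quarter_def norm_v norm_w \<omega>_vw)

text \<open>Both the displacement of the chord point and the change of its norm are at most
  \<open>2 * \<bar>t - s\<bar>\<close>; dividing their sum by a norm of at least 1/2 gives the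
  constant 8.\<close>

lemma quarter_path_lipschitz:
  "norm (quarter_path t - quarter_path s) \<le> 8 * \<bar>t - s\<bar>"
proof -
  have d: "norm (chord t - chord s) \<le> 2 * \<bar>t - s\<bar>"
  proof -
    have "chord t - chord s = (t - s) *\<^sub>R (w - v)" by (simp add: chord_def algebra_simps)
    moreover have "norm (w - v) \<le> 2" using norm_triangle_ineq4[of w v] norm_v norm_w by simp
    ultimately show ?thesis by (simp add: mult.commute[of 2] mult_left_mono)
  qed
  define p q where "p = norm (chord t)" and "q = norm (chord s)"
  have pq: "p \<ge> 1 / 2" "p > 0" "q > 0" using norm_chord_ge norm_chord_pos by (auto simp: p_def q_def)
  have "quarter_path t - quarter_path s = (1 / p) *\<^sub>R (chord t - chord s) + (1 / p - 1 / q) *\<^sub>R chord s"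
    by (simp add: quarter_path_def p_def q_def algebra_simps)
  then have "norm (quarter_path t - quarter_path s)
      \<le> norm (chord t - chord s) / p + \<bar>1 / p - 1 / q\<bar> * q"
    using pq norm_triangle_ineq[of "(1 / p) *\<^sub>R (chord t - chord s)" "(1 / p - 1 / q) *\<^sub>R chord s"]
    by (simp add: q_def)
  also have "\<bar>1 / p - 1 / q\<bar> * q = \<bar>(1 / p - 1 / q) * q\<bar>" using pq by (simp add: abs_mult)
  also have "(1 / p - 1 / q) * q = (q - p) / p" using pq by (simp add: field_simps)
  also have "\<bar>(q - p) / p\<bar> = \<bar>p - q\<bar> / p" using pq by (simp add: abs_minus_commute)
  also have "norm (chord t - chord s) / p + \<bar>p - q\<bar> / p \<le> (4 * \<bar>t - s\<bar>) / p"
  proof -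
    have "\<bar>p - q\<bar> \<le> norm (chord t - chord s)" unfolding p_def q_def by (rule norm_triangle_ineq3)
    then show ?thesis using d pq by (simp add: add_divide_distrib[symmetric] divide_right_mono)
  qed
  also have "\<dots> \<le> (4 * \<bar>t - s\<bar>) / (1 / 2)" using pq by (intro divide_left_mono) auto
  finally show ?thesis by simp
qed

section \<open>Maximal areas and monotone coordinates on the quarter\<close>

text \<open>Under the sign condition the two products in the determinant have the same sign, so
  their difference is no larger than the larger of them. Such a unit vector \<open>x\<close> never
  beats both \<open>v\<close> and \<open>w\<close>.\<close>

lemma same_quadrant_bound:
  assumes "0 \<le> (\<omega> x w * \<omega> v x) * (\<omega> y w * \<omega> v y)"
  shows "\<bar>\<omega> x y\<bar> \<le> norm x * max \<bar>\<omega> y w\<bar> \<bar>\<omega> v y\<bar>"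
proof -
  have "\<bar>\<omega> x y\<bar> \<le> max \<bar>\<omega> x w * \<omega> v y\<bar> \<bar>\<omega> v x * \<omega> y w\<bar>"
    unfolding \<omega>_coord[of x y] using assms by (intro diff_abs_le_max) (simp add: mult.commute mult.left_commute)
  also have "\<dots> \<le> norm x * max \<bar>\<omega> y w\<bar> \<bar>\<omega> v y\<bar>"
    by (auto simp: abs_mult intro!: mult_mono coord_v_le coord_w_le)
  finally show ?thesis .
qed

text \<open>Compactness gives a maximizer on the quarter. It dominates the whole plane: homogeneity
  covers the first and third quadrants, and in the other two \<open>same_quadrant_bound\<close>
  reduces the comparison to \<open>v\<close> and \<open>w\<close>, which lie on the quarter.\<close>

lemma quarter_maximizer:
  assumes y: "\<omega> y w \<le> 0" "0 \<le> \<omega> v y"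
  obtains x where "x \<in> quarter" "0 \<le> \<omega> x y" "\<And>z. \<bar>\<omega> z y\<bar> \<le> norm z * \<omega> x y"
proof -
  obtain x where x: "x \<in> quarter" and max: "\<And>z. z \<in> quarter \<Longrightarrow> \<omega> z y \<le> \<omega> x y"
    using continuous_attains_sup[OF compact_quarter _ continuous_on_\<omega>_left] v_in_quarter by blast
  have nonneg: "0 \<le> \<omega> z y" if "0 \<le> \<omega> z w" "0 \<le> \<omega> v z" for z
  proof -
    have "0 \<le> \<omega> z w * \<omega> v y" "\<omega> v z * \<omega> y w \<le> 0"
      using that y by (auto simp: mult_nonneg_nonpos)
    then show ?thesis using \<omega>_coord[of z y] by simp
  qed
  have mv: "\<bar>\<omega> v y\<bar> \<le> \<omega> x y" using max[OF v_in_quarter] y by simp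
  have mw: "\<bar>\<omega> y w\<bar> \<le> \<omega> x y" using max[OF w_in_quarter] y \<omega>_flip[of w y] by simp
  have x0: "0 \<le> \<omega> x y" using mv by linarith
  have pos: "\<bar>\<omega> z y\<bar> \<le> norm z * \<omega> x y" if z: "0 \<le> \<omega> z w" "0 \<le> \<omega> v z" for z
  proof (cases "z = 0")
    case False
    then have "(1 / norm z) *\<^sub>R z \<in> quarter" using z by (simp add: quarter_def)
    then have "\<omega> ((1 / norm z) *\<^sub>R z) y \<le> \<omega> x y" by (rule max)
    then show ?thesis using False nonneg[OF z] by (simp add: field_simps)
  qed auto
  have "\<bar>\<omega> z y\<bar> \<le> norm z * \<omega> x y" for z
  proof (cases "0 \<le> \<omega> z w * \<omega> v z")
    case True
    then consider "0 \<le> \<omega> z w" "0 \<le> \<omega> v z" | "\<omega> z w \<le> 0" "\<omega> v z \<le> 0"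
      by (auto simp: zero_le_mult_iff)
    then show ?thesis
    proof cases
      case 2
      then show ?thesis using pos[of "- z"] by simp
    qed (rule pos)
  next
    case False
    then have "0 \<le> (\<omega> z w * \<omega> v z) * (\<omega> y w * \<omega> v y)"
      using y by (intro mult_nonpos_nonpos) (auto simp: mult_nonpos_nonneg)
    then have "\<bar>\<omega> z y\<bar> \<le> norm z * max \<bar>\<omega> y w\<bar> \<bar>\<omega> v y\<bar>" by (rule same_quadrant_bound)
    also have "\<dots> \<le> norm z * \<omega> x y" using mv mw by (intro mult_left_mono) auto
    finally show ?thesis .
  qed
  then show thesis using that x x0 by blast
qed

text \<open>The shrunken vector is a convex combination of the original one and its
  \<open>w\<close>-component, which is no longer than the original because the coordinate is bounded
  by the norm.\<close>

lemma norm_shrink_v: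
  assumes "0 \<le> c" "c \<le> 1"
  shows "norm ((c * a) *\<^sub>R v + b *\<^sub>R w) \<le> norm (a *\<^sub>R v + b *\<^sub>R w)"
proof -
  have eq: "(c * a) *\<^sub>R v + b *\<^sub>R w = c *\<^sub>R (a *\<^sub>R v + b *\<^sub>R w) + (1 - c) *\<^sub>R (b *\<^sub>R w)"
    by (simp add: algebra_simps)
  have b: "norm (b *\<^sub>R w) \<le> norm (a *\<^sub>R v + b *\<^sub>R w)"
    using coord_w_le[of "a *\<^sub>R v + b *\<^sub>R w"] by (simp add: norm_w \<omega>_vw)
  have "norm ((c * a) *\<^sub>R v + b *\<^sub>R w)
      \<le> c * norm (a *\<^sub>R v + b *\<^sub>R w) + (1 - c) * norm (b *\<^sub>R w)"
    unfolding eq using norm_triangle_ineq[of "c *\<^sub>R (a *\<^sub>R v + b *\<^sub>R w)" "(1 - c) *\<^sub>R (b *\<^sub>R w)"] assms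
    by (simp add: abs_mult)
  also have "\<dots> \<le> c * norm (a *\<^sub>R v + b *\<^sub>R w) + (1 - c) * norm (a *\<^sub>R v + b *\<^sub>R w)"
    using assms by (intro add_left_mono mult_left_mono b) auto
  finally show ?thesis by (simp add: algebra_simps)
qed

lemma norm_shrink_w:
  assumes "0 \<le> c" "c \<le> 1"
  shows "norm (a *\<^sub>R v + (c * b) *\<^sub>R w) \<le> norm (a *\<^sub>R v + b *\<^sub>R w)"
  using unit_frame.norm_shrink_v[OF rotated assms, of b "- a"] by (simp add: add.commute)

lemma norm_mono_coords:
  assumes "0 \<le> \<omega> x w" "\<omega> x w \<le> \<omega> y w" "0 \<le> \<omega> v x" "\<omega> v x \<le> \<omega> v y"
  shows "norm x \<le> norm y"
proof -
  obtain c d where c: "0 \<le> c" "c \<le> 1" "\<omega> x w = c * \<omega> y w" and d: "0 \<le> d" "d \<le> 1" "\<omega> v x = d * \<omega> v y"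
  proof
    show "\<omega> x w = \<omega> x w / \<omega> y w * \<omega> y w" "\<omega> v x = \<omega> v x / \<omega> v y * \<omega> v y" using assms by auto
  qed (use assms in \<open>auto simp: divide_le_eq_1\<close>)
  have "norm x = norm ((c * \<omega> y w) *\<^sub>R v + (d * \<omega> v y) *\<^sub>R w)" using expand[of x] c d by simp
  also have "\<dots> \<le> norm (\<omega> y w *\<^sub>R v + (d * \<omega> v y) *\<^sub>R w)" using c by (intro norm_shrink_v)
  also have "\<dots> \<le> norm (\<omega> y w *\<^sub>R v + \<omega> v y *\<^sub>R w)" using d by (intro norm_shrink_w)
  also have "\<dots> = norm y" using expand[of y] by simp
  finally show ?thesis .
qed

lemma norm_mono_scaled:
  assumes "0 \<le> c" "0 \<le> \<omega> x w" "c * \<omega> x w \<le> \<omega> y w" "0 \<le> \<omega> v x" "c * \<omega> v x \<le> \<omega> v y"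
  shows "c * norm x \<le> norm y"
  using norm_mono_coords[of "c *\<^sub>R x" y] assms by simp

text \<open>If a coordinate moved the wrong way, one of the two unit vectors would dominate,
  coordinate by coordinate, a multiple of the other by a factor above 1. The norm is monotone in
  nonnegative coordinates, so this is impossible.\<close>

lemma quarter_coords_mono:
  assumes x: "x \<in> quarter" and y: "y \<in> quarter" and pos: "0 \<le> \<omega> x y"
  shows "\<omega> y w \<le> \<omega> x w \<and> \<omega> v x \<le> \<omega> v y"
proof -
  have nx: "norm x = 1" "0 \<le> \<omega> x w" "0 \<le> \<omega> v x" and ny: "norm y = 1" "0 \<le> \<omega> y w" "0 \<le> \<omega> v y"
    using x y by (auto simp: quarter_def)
  have le: "\<omega> v x * \<omega> y w \<le> \<omega> x w * \<omega> v y" using pos \<omega>_coord[of x y] by simp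
  have zx: "\<not> (\<omega> x w = 0 \<and> \<omega> v x = 0)" using nx expand[of x] by auto
  have zy: "\<not> (\<omega> y w = 0 \<and> \<omega> v y = 0)" using ny expand[of y] by auto
  have "\<omega> y w \<le> \<omega> x w"
  proof (rule ccontr)
    assume *: "\<not> \<omega> y w \<le> \<omega> x w"
    have "\<omega> x w \<noteq> 0"
    proof
      assume "\<omega> x w = 0"
      then have "\<omega> v x * \<omega> y w \<le> 0" using le by simp
      then show False using * nx zx \<open>\<omega> x w = 0\<close> by (auto simp: mult_le_0_iff)
    qed
    then have a: "\<omega> x w > 0" using nx by simp
    have "\<omega> y w / \<omega> x w * norm x \<le> norm y"
      using a nx ny le by (intro norm_mono_scaled) (auto simp: field_simps)
    then show False using a nx ny * by (simp add: field_simps)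
  qed
  moreover have "\<omega> v x \<le> \<omega> v y"
  proof (rule ccontr)
    assume *: "\<not> \<omega> v x \<le> \<omega> v y"
    have "\<omega> v y \<noteq> 0"
    proof
      assume "\<omega> v y = 0"
      then have "\<omega> v x * \<omega> y w \<le> 0" using le by simp
      then show False using * ny zy \<open>\<omega> v y = 0\<close> by (auto simp: mult_le_0_iff)
    qed
    then have a: "\<omega> v y > 0" using ny by simp
    have "\<omega> v x / \<omega> v y * norm y \<le> norm x"
      using a nx ny le by (intro norm_mono_scaled) (auto simp: field_simps)
    then show False using a nx ny * by (simp add: field_simps)
  qed
  ultimately show ?thesis ..
qed

section \<open>The dual norm on the second quadrant, and symmetry of orthogonality from a unit
  second arc\<close>

lemma next_quarter: "unit_frame.quarter \<omega> w (- v) = {y. norm y = 1 \<and> \<omega> y w \<le> 0 \<and> 0 \<le> \<omega> v y}"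
proof -
  interpret R: unit_frame \<omega> w "- v" by (rule rotated)
  have "\<omega> y v = - \<omega> v y" "\<omega> w y = - \<omega> y w" for y by (rule \<omega>_flip)+
  then show ?thesis unfolding R.quarter_def by auto
qed

text \<open>The supremum in \<open>radon_gamma2\<close> ranges over the quarter only, yet it is
  attained and already equals the dual norm taken over the whole unit circle.\<close>

lemma second_quadrant_SUP:
  assumes y: "\<omega> y w \<le> 0" "0 \<le> \<omega> v y"
  obtains x where "x \<in> quarter" "\<And>z. \<bar>\<omega> z y\<bar> \<le> norm z * \<bar>\<omega> x y\<bar>"
    "(SUP x\<in>quarter. \<bar>\<omega> x y\<bar>) = \<bar>\<omega> x y\<bar>"
proof -
  obtain x where x: "x \<in> quarter" "0 \<le> \<omega> x y" "\<And>z. \<bar>\<omega> z y\<bar> \<le> norm z * \<omega> x y"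
    using quarter_maximizer[OF y] by blast
  have "(SUP x\<in>quarter. \<bar>\<omega> x y\<bar>) = \<bar>\<omega> x y\<bar>"
  proof (rule cSup_eq_maximum)
    show "\<bar>\<omega> x y\<bar> \<in> (\<lambda>x. \<bar>\<omega> x y\<bar>) ` quarter" using x by blast
    fix a assume "a \<in> (\<lambda>x. \<bar>\<omega> x y\<bar>) ` quarter"
    then obtain z where "norm z = 1" "a = \<bar>\<omega> z y\<bar>" by (auto simp: quarter_def)
    then show "a \<le> \<bar>\<omega> x y\<bar>" using x(2) x(3)[of z] by simp
  qed
  then show thesis using that[of x] x by simp
qed

text \<open>The factor \<open>r\<close> may be negative, so the second and fourth quadrants are
  treated together.\<close>

lemma second_quadrant_scaled:
  assumes y: "\<omega> y w * \<omega> v y \<le> 0"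
  obtains r l where "l \<in> {0..1}" "y = r *\<^sub>R ((1 - l) *\<^sub>R w + l *\<^sub>R (- v))"
proof (cases "\<omega> v y - \<omega> y w = 0")
  case True
  then have "\<omega> v y = 0" "\<omega> y w = 0" using y mult_le_0_iff[of "\<omega> y w" "\<omega> y w"] by auto
  then show thesis using that[of 0 0] expand[of y] by simp
next
  case False
  define r l where "r = \<omega> v y - \<omega> y w" and "l = - \<omega> y w / r"
  have "\<omega> y w \<le> 0 \<and> 0 \<le> \<omega> v y \<or> 0 \<le> \<omega> y w \<and> \<omega> v y \<le> 0"
    using y by (auto simp: mult_le_0_iff)
  then have "l \<in> {0..1}" using False by (auto simp: r_def l_def divide_simps)
  moreover have "y = r *\<^sub>R ((1 - l) *\<^sub>R w + l *\<^sub>R (- v))"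
    by (rule coord_eqI) (use False in \<open>auto simp: \<omega>_vw r_def l_def field_simps\<close>)
  ultimately show thesis using that by blast
qed

text \<open>Once \<open>le\<close> and \<open>norming\<close> identify the dual norm with the norm,
  \<open>x \<stileturn>\<^sub>B y\<close> reads
  \<open>\<bar>\<omega> x y\<bar> = norm x * norm y\<close>, which is symmetric.\<close>

lemma birkhoff_symmetric_if_gamma2_unit:
  assumes unit: "\<And>l. l \<in> {0..1} \<Longrightarrow> norm (radon_gamma2 \<omega> v w quarter l) = 1"
    and orth: "(x :: 'a) \<stileturn>\<^sub>B y"
  shows "y \<stileturn>\<^sub>B x"
proof -
  have second: "(\<forall>z. \<bar>\<omega> z y\<bar> \<le> norm z * norm y) \<and> (\<exists>x. norm x = 1 \<and> \<bar>\<omega> x y\<bar> = norm y)"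
    if quad: "\<omega> y w * \<omega> v y \<le> 0" for y
  proof -
    obtain r l where l: "l \<in> {0..1}" and y: "y = r *\<^sub>R ((1 - l) *\<^sub>R w + l *\<^sub>R (- v))"
      using second_quadrant_scaled[OF quad] by blast
    define u where "u = (1 - l) *\<^sub>R w + l *\<^sub>R (- v)"
    have u: "\<omega> u w \<le> 0" "0 \<le> \<omega> v u" using l by (auto simp: u_def \<omega>_vw)
    obtain x where x: "x \<in> quarter" "\<And>z. \<bar>\<omega> z u\<bar> \<le> norm z * \<bar>\<omega> x u\<bar>"
      "(SUP x\<in>quarter. \<bar>\<omega> x u\<bar>) = \<bar>\<omega> x u\<bar>"
      using second_quadrant_SUP[OF u] by blast
    have "norm ((1 / \<bar>\<omega> x u\<bar>) *\<^sub>R u) = 1"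
      using unit[OF l] unfolding radon_gamma2_def Let_def u_def[symmetric] x(3) .
    then have nu: "\<bar>\<omega> x u\<bar> = norm u" by (cases "\<omega> x u = 0") (auto simp: field_simps)
    have yu: "y = r *\<^sub>R u" by (simp only: y u_def)
    have ry: "\<bar>\<omega> z y\<bar> = \<bar>r\<bar> * \<bar>\<omega> z u\<bar>" "norm y = \<bar>r\<bar> * norm u" for z
      by (auto simp: yu abs_mult)
    have "\<bar>\<omega> z y\<bar> \<le> norm z * norm y" for z
      using mult_left_mono[OF x(2)[of z], of "\<bar>r\<bar>"] by (simp add: ry nu mult_ac)
    moreover have "norm x = 1" using x(1) by (simp add: quarter_def)
    ultimately show ?thesis using ry nu by auto
  qed
  \<comment> \<open>By antisymmetry it suffices that one of the vectors lies in the second or fourth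
    quadrant; otherwise \<open>same_quadrant_bound\<close> applies.\<close>
  have le: "\<bar>\<omega> x y\<bar> \<le> norm x * norm y" for x y
  proof -
    consider "\<omega> y w * \<omega> v y \<le> 0" | "\<omega> x w * \<omega> v x \<le> 0"
      | "0 \<le> \<omega> x w * \<omega> v x" "0 \<le> \<omega> y w * \<omega> v y" by linarith
    then show ?thesis
    proof cases
      case 1
      then show ?thesis using second by blast
    next
      case 2
      then have "\<bar>\<omega> y x\<bar> \<le> norm y * norm x" using second by blast
      then show ?thesis using \<omega>_flip[of y x] by (simp add: mult.commute)
    next
      case 3
      then have "\<bar>\<omega> x y\<bar> \<le> norm x * max \<bar>\<omega> y w\<bar> \<bar>\<omega> v y\<bar>" by (intro same_quadrant_bound) simp
      also have "\<dots> \<le> norm x * norm y" using coord_v_le coord_w_le by (intro mult_left_mono) auto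
      finally show ?thesis .
    qed
  qed
  \<comment> \<open>This is biduality: choose \<open>z\<close> with
    \<open>y \<stileturn>\<^sub>B z\<close>. If \<open>z\<close> lies in the second or fourth
    quadrant, its dual norm is known and the normalized \<open>z\<close> norms \<open>y\<close>. If
    neither \<open>y\<close> nor \<open>z\<close> does, testing the orthogonality at
    \<open>v\<close> and \<open>w\<close> shows that one of these norms \<open>y\<close>.\<close>
  have norming: "\<exists>x. norm x = 1 \<and> norm y \<le> \<bar>\<omega> x y\<bar>" for y
  proof (cases "y = 0")
    case True
    then show ?thesis using norm_v by auto
  next
    case False
    have "\<omega> y v \<noteq> 0 \<or> \<omega> y w \<noteq> 0"
      using False coord_eqI[of y 0] \<omega>_flip[of y v] by auto
    then obtain e where e: "\<omega> y e \<noteq> 0" by blast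
    obtain c where orth: "y \<stileturn>\<^sub>B (norm y *\<^sub>R e - c *\<^sub>R y)"
      using birkhoff_orthogonal_exists_right[OF False] .
    define z where "z = norm y *\<^sub>R e - c *\<^sub>R y"
    have z0: "z \<noteq> 0" using e False by (auto simp: z_def dest: arg_cong[of _ _ "\<omega> y"])
    have dom: "norm y * \<bar>\<omega> u z\<bar> \<le> norm u * \<bar>\<omega> y z\<bar>" for u
      using orth unfolding birkhoff_orthogonal_iff z_def[symmetric] by blast
    show ?thesis
    proof (cases "\<omega> z w * \<omega> v z \<le> 0 \<or> \<omega> y w * \<omega> v y \<le> 0")
      case True
      then consider "\<omega> z w * \<omega> v z \<le> 0" | "\<omega> y w * \<omega> v y \<le> 0" by blast
      then show ?thesis
      proof cases
        case 1
        then obtain u where "norm u = 1" "\<bar>\<omega> u z\<bar> = norm z" using second by blast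
        then have "norm y * norm z \<le> \<bar>\<omega> y z\<bar>" using dom[of u] by simp
        then have "norm y \<le> \<bar>\<omega> ((1 / norm z) *\<^sub>R z) y\<bar>"
          using z0 \<omega>_flip[of z y] by (simp add: field_simps)
        then show ?thesis using z0 by (intro exI[of _ "(1 / norm z) *\<^sub>R z"]) simp
      next
        case 2
        then show ?thesis using second[of y] by auto
      qed
    next
      case False
      have a: "norm y * \<bar>\<omega> z w\<bar> \<le> \<bar>\<omega> y z\<bar>" using dom[of w] \<omega>_flip[of w z] norm_w by simp
      have b: "norm y * \<bar>\<omega> v z\<bar> \<le> \<bar>\<omega> y z\<bar>" using dom[of v] norm_v by simp
      have nz: "\<omega> z w \<noteq> 0" "\<omega> v z \<noteq> 0" using False by auto
      have "\<bar>\<omega> y z\<bar> \<le> max \<bar>\<omega> y w * \<omega> v z\<bar> \<bar>\<omega> v y * \<omega> z w\<bar>"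
        unfolding \<omega>_coord[of y z] using False
        by (intro diff_abs_le_max) (use mult_nonneg_nonneg[of "\<omega> z w * \<omega> v z" "\<omega> y w * \<omega> v y"] in
            \<open>simp add: mult_ac\<close>)
      then consider "norm y * \<bar>\<omega> v z\<bar> \<le> \<bar>\<omega> y w\<bar> * \<bar>\<omega> v z\<bar>"
        | "norm y * \<bar>\<omega> z w\<bar> \<le> \<bar>\<omega> v y\<bar> * \<bar>\<omega> z w\<bar>"
        using a b by (fastforce simp: max_def abs_mult split: if_splits)
      then show ?thesis
      proof cases
        case 1
        then have "norm y \<le> \<bar>\<omega> w y\<bar>" using nz \<omega>_flip[of w y] by simp
        then show ?thesis using norm_w by blast
      next
        case 2
        then have "norm y \<le> \<bar>\<omega> v y\<bar>" using nz by simp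
        then show ?thesis using norm_v by blast
      qed
    qed
  qed
  obtain u where u: "norm u = 1" "norm y \<le> \<bar>\<omega> u y\<bar>" using norming by blast
  have "norm x * norm y \<le> norm x * \<bar>\<omega> u y\<bar>" using u by (intro mult_left_mono) auto
  also have "\<dots> \<le> \<bar>\<omega> x y\<bar>" using orth u unfolding birkhoff_orthogonal_iff by (metis mult_1)
  finally have xy: "norm x * norm y \<le> \<bar>\<omega> y x\<bar>" using \<omega>_flip[of y x] by simp
  show ?thesis unfolding birkhoff_orthogonal_iff
  proof
    fix z
    have "norm y * \<bar>\<omega> z x\<bar> \<le> norm y * (norm z * norm x)" using le by (intro mult_left_mono) auto
    also have "\<dots> = norm z * (norm x * norm y)" by simp
    also have "\<dots> \<le> norm z * \<bar>\<omega> y x\<bar>" using xy by (intro mult_left_mono) auto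
    finally show "norm y * \<bar>\<omega> z x\<bar> \<le> norm z * \<bar>\<omega> y x\<bar>" .
  qed
qed

section \<open>Conjugate unit vectors and their constant area\<close>

text \<open>For a unit vector \<open>x\<close> the two bounds express
  \<open>x \<stileturn>\<^sub>B y\<close> and \<open>y \<stileturn>\<^sub>B x\<close>, with the
  orientation fixed by a nonnegative area: it is maximal in each argument separately.\<close>

definition conjugate :: "'a \<Rightarrow> 'a \<Rightarrow> bool"
  where "conjugate x y \<longleftrightarrow> norm y = 1 \<and> \<omega> y w \<le> 0 \<and> 0 \<le> \<omega> v y \<and>
    (\<forall>z. \<bar>\<omega> z y\<bar> \<le> norm z * \<omega> x y) \<and> (\<forall>z. \<bar>\<omega> x z\<bar> \<le> norm z * \<omega> x y)"

text \<open>In the rotated frame \<open>- x\<close> lies in the second quadrant, so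
  \<open>quarter_maximizer\<close> yields \<open>y\<close> with
  \<open>y \<stileturn>\<^sub>B x\<close>; symmetry supplies the other bound.\<close>

lemma conjugate_exists:
  assumes sym: "\<And>x y :: 'a. x \<stileturn>\<^sub>B y \<Longrightarrow> y \<stileturn>\<^sub>B x" and x: "x \<in> quarter"
  obtains y where "conjugate x y"
proof -
  have nx: "norm x = 1" "0 \<le> \<omega> x w" "0 \<le> \<omega> v x" using x by (auto simp: quarter_def)
  have "\<omega> (- x) (- v) \<le> 0" "0 \<le> \<omega> w (- x)" using nx \<omega>_flip[of x v] \<omega>_flip[of w x] by auto
  then obtain y where y: "y \<in> {y. norm y = 1 \<and> \<omega> y w \<le> 0 \<and> 0 \<le> \<omega> v y}" "0 \<le> \<omega> y (- x)"
    "\<And>z. \<bar>\<omega> z (- x)\<bar> \<le> norm z * \<omega> y (- x)"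
    using unit_frame.quarter_maximizer[OF rotated, of "- x", unfolded next_quarter] by blast
  have flip: "\<omega> y (- x) = \<omega> x y" using \<omega>_flip[of y x] by simp
  have dom: "\<bar>\<omega> x z\<bar> \<le> norm z * \<omega> x y" for z
    using y(3)[of z, unfolded flip] \<omega>_flip[of z x] by simp
  have "y \<stileturn>\<^sub>B x" unfolding birkhoff_orthogonal_iff
    using y dom flip \<omega>_flip[of _ x] by (auto simp: abs_minus_commute)
  then have "x \<stileturn>\<^sub>B y" by (rule sym)
  then have "\<bar>\<omega> z y\<bar> \<le> norm z * \<omega> x y" for z
    using nx y flip unfolding birkhoff_orthogonal_iff by (metis abs_of_nonneg mult_1)
  then show thesis using that[of y] y dom flip by (auto simp: conjugate_def)
qed

lemma conjugate_bounds:
  assumes "conjugate x y" "norm z = 1"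
  shows "\<bar>\<omega> z y\<bar> \<le> \<omega> x y" "\<bar>\<omega> x z\<bar> \<le> \<omega> x y"
proof -
  have "\<bar>\<omega> z y\<bar> \<le> norm z * \<omega> x y" "\<bar>\<omega> x z\<bar> \<le> norm z * \<omega> x y"
    using assms(1) unfolding conjugate_def by blast+
  then show "\<bar>\<omega> z y\<bar> \<le> \<omega> x y" "\<bar>\<omega> x z\<bar> \<le> \<omega> x y" by (simp_all add: assms(2))
qed

text \<open>By maximality the product of the two mixed areas is at most the product of the conjugate
  areas, and \<open>pluecker\<close> evaluates the difference.\<close>

lemma conjugate_mono:
  assumes conj: "conjugate x y" "conjugate x' y'"
    and nx: "norm x = 1" "norm x' = 1" and pos: "0 < \<omega> x x'"
  shows "0 \<le> \<omega> y y'"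
proof -
  have "\<omega> x' y * \<omega> x y' \<le> \<bar>\<omega> x' y\<bar> * \<bar>\<omega> x y'\<bar>" by (metis abs_ge_self abs_mult)
  also have "\<dots> \<le> \<omega> x y * \<omega> x' y'"
    using conjugate_bounds(1)[OF conj(1) nx(2)] conjugate_bounds(1)[OF conj(2) nx(1)]
    by (intro mult_mono) auto
  finally have "\<omega> y' y * \<omega> x x' \<le> 0" using pluecker[of x' y x y'] by (simp add: mult.commute)
  then show ?thesis using pos \<omega>_flip[of y y'] by (auto simp: mult_le_0_iff)
qed

text \<open>The right-hand side is the sum of both conjugate areas minus the two mixed areas, and
  each mixed area is at most the smaller conjugate area.\<close>

lemma conjugate_area_diff:
  assumes conj: "conjugate x y" "conjugate x' y'" and nx: "norm x = 1" "norm x' = 1"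
  shows "\<bar>\<omega> x' y' - \<omega> x y\<bar> \<le> \<omega> (x' - x) (y' - y)"
proof -
  have ny: "norm y = 1" "norm y' = 1" using conj by (auto simp: conjugate_def)
  show ?thesis
    using conjugate_bounds(1)[OF conj(1) nx(2)] conjugate_bounds(2)[OF conj(1) ny(2)]
      conjugate_bounds(2)[OF conj(2) ny(1)] conjugate_bounds(1)[OF conj(2) nx(1)]
    by simp
qed

text \<open>The area \<open>\<omega> x y\<close> of conjugate unit vectors varies by at most \<open>\<omega> (dx) (dy)\<close>, a product of two
  increments, and \<open>y\<close> moves monotonically with \<open>x\<close>; hence the area is constant.\<close>

lemma conjugate_area:
  assumes sym: "\<And>x y :: 'a. x \<stileturn>\<^sub>B y \<Longrightarrow> y \<stileturn>\<^sub>B x" and x: "x \<in> quarter" and y: "conjugate x y"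
  shows "\<omega> x y = 1"
proof -
  obtain b where b: "b \<in> {0..1}" "x = quarter_path b" using x quarter_path_image by blast
  have "\<exists>y. conjugate (quarter_path t) y" if "t \<in> {0..1}" for t
    using that quarter_path_image conjugate_exists[OF sym] by blast
  then obtain c where c: "\<And>t. t \<in> {0..1} \<Longrightarrow> conjugate (quarter_path t) (c t)" by metis
  define h where "h t = \<omega> (quarter_path t) (c t)" for t
  \<comment> \<open>Both coordinates of \<open>c t\<close> decrease as \<open>t\<close> grows, so
    increments of \<open>Y\<close> are the sums of the absolute coordinate changes.\<close>
  define Y where "Y t = - \<omega> v (c t) - \<omega> (c t) w" for t
  have "h b = h 0"
  proof (rule constant_if_increments_le_mono[where C = 8 and Y = Y and h = h and a = 0])
    fix s t assume st: "0 \<le> s" "s \<le> t" "t \<le> b"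
    have cs: "conjugate (quarter_path s) (c s)" and ct: "conjugate (quarter_path t) (c t)"
      using st b by (auto intro!: c)
    have mono: "\<omega> v (c t) \<le> \<omega> v (c s) \<and> \<omega> (c t) w \<le> \<omega> (c s) w"
    proof (cases "s = t")
      case False
      have "\<omega> (quarter_path s) (quarter_path t) = (t - s) / (norm (chord s) * norm (chord t))"
        unfolding \<omega>_coord[of "quarter_path s" "quarter_path t"] quarter_path_coords
        by (simp add: diff_divide_distrib[symmetric] algebra_simps)
      also have "\<dots> > 0" using False st norm_chord_pos by simp
      finally have "0 \<le> \<omega> (c s) (c t)"
        using conjugate_mono[OF cs ct norm_quarter_path norm_quarter_path] by blast
      moreover have "c s \<in> unit_frame.quarter \<omega> w (- v)" "c t \<in> unit_frame.quarter \<omega> w (- v)"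
        using cs ct by (auto simp: next_quarter conjugate_def)
      ultimately show ?thesis
        using unit_frame.quarter_coords_mono[OF rotated, of "c s" "c t"]
          \<omega>_flip[of "c s" v] \<omega>_flip[of "c t" v] \<omega>_flip[of w "c s"] \<omega>_flip[of w "c t"] by auto
    qed auto
    define dx dy where "dx = quarter_path t - quarter_path s" and "dy = c t - c s"
    have dy: "\<bar>\<omega> v dy\<bar> + \<bar>\<omega> dy w\<bar> = Y t - Y s" using mono by (simp add: dy_def Y_def)
    have "\<bar>h t - h s\<bar> \<le> \<omega> dx dy"
      unfolding h_def dx_def dy_def by (intro conjugate_area_diff cs ct norm_quarter_path)
    also have "\<dots> \<le> \<bar>\<omega> dx w\<bar> * \<bar>\<omega> v dy\<bar> + \<bar>\<omega> v dx\<bar> * \<bar>\<omega> dy w\<bar>"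
      unfolding \<omega>_coord[of dx dy] abs_mult[symmetric] by linarith
    also have "\<dots> \<le> norm dx * \<bar>\<omega> v dy\<bar> + norm dx * \<bar>\<omega> dy w\<bar>"
      by (intro add_mono mult_right_mono coord_v_le coord_w_le) auto
    also have "\<dots> = norm dx * (Y t - Y s)" using dy by (simp add: distrib_left[symmetric])
    also have "\<dots> \<le> 8 * (t - s) * (Y t - Y s)"
      using quarter_path_lipschitz[of t s] st dy by (intro mult_right_mono) (auto simp: dx_def)
    finally show "\<bar>h t - h s\<bar> \<le> 8 * (t - s) * (Y t - Y s)" .
  qed (use b in auto)
  \<comment> \<open>At the starting point \<open>v\<close> the area is at most 1 by the coordinate
    bound and at least 1 by maximality against \<open>w\<close>.\<close>
  moreover have "h 0 = 1"
  proof (rule antisym)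
    have c0: "conjugate v (c 0)" using c[of 0] quarter_path_0 by simp
    then show "h 0 \<le> 1" using coord_w_le[of "c 0"] by (simp add: h_def quarter_path_0 conjugate_def)
    have "\<bar>\<omega> v w\<bar> \<le> norm w * \<omega> v (c 0)" using c0 unfolding conjugate_def by blast
    then show "1 \<le> h 0" by (simp add: h_def quarter_path_0 norm_w \<omega>_vw)
  qed
  \<comment> \<open>The chosen conjugate \<open>c b\<close> may differ from \<open>y\<close>, but
    maximality of both areas makes them equal.\<close>
  moreover have "\<omega> x y = h b"
  proof -
    have cb: "conjugate x (c b)" using c b by auto
    have "norm y = 1" "norm (c b) = 1" using y cb by (auto simp: conjugate_def)
    then have "\<bar>\<omega> x y\<bar> \<le> \<omega> x (c b)" "\<bar>\<omega> x (c b)\<bar> \<le> \<omega> x y"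
      using conjugate_bounds(2) y cb by blast+
    then show ?thesis by (simp add: h_def b)
  qed
  ultimately show ?thesis by simp
qed

text \<open>The maximizer \<open>x\<close> has a conjugate \<open>c\<close> of area 1. Maximality of
  that area bounds the supremum by \<open>norm y\<close>; testing
  \<open>y \<stileturn>\<^sub>B x\<close> against \<open>c\<close> gives the reverse.\<close>

lemma SUP_quarter_eq_norm:
  assumes sym: "\<And>x y :: 'a. x \<stileturn>\<^sub>B y \<Longrightarrow> y \<stileturn>\<^sub>B x" and y: "\<omega> y w \<le> 0" "0 \<le> \<omega> v y"
  shows "(SUP x\<in>quarter. \<bar>\<omega> x y\<bar>) = norm y"
proof -
  obtain x where x: "x \<in> quarter" and dom: "\<And>z. \<bar>\<omega> z y\<bar> \<le> norm z * \<bar>\<omega> x y\<bar>"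
    and sup: "(SUP x\<in>quarter. \<bar>\<omega> x y\<bar>) = \<bar>\<omega> x y\<bar>"
    using second_quadrant_SUP[OF y] by blast
  obtain c where c: "conjugate x c" using conjugate_exists[OF sym x] .
  have xc: "\<omega> x c = 1" using conjugate_area[OF sym x c] .
  have nx: "norm x = 1" using x by (simp add: quarter_def)
  have "x \<stileturn>\<^sub>B y" unfolding birkhoff_orthogonal_iff using dom nx by simp
  then have "y \<stileturn>\<^sub>B x" by (rule sym)
  then have "norm y * \<bar>\<omega> c x\<bar> \<le> norm c * \<bar>\<omega> y x\<bar>" unfolding birkhoff_orthogonal_iff by blast
  then have "norm y \<le> \<bar>\<omega> x y\<bar>"
    using c xc \<omega>_flip[of c x] \<omega>_flip[of y x] by (simp add: conjugate_def)
  moreover have "\<bar>\<omega> x y\<bar> \<le> norm y" using c xc unfolding conjugate_def by (metis mult.right_neutral)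
  ultimately show ?thesis using sup by simp
qed

section \<open>The sector as a convex body, and the unit circle as a Radon curve\<close>

definition sector :: "'a set"
  where "sector = {x. 0 \<le> \<omega> x w \<and> 0 \<le> \<omega> v x \<and> norm x \<le> 1}"

text \<open>The sector is the continuous image of a closed part of the unit coordinate
  square.\<close>

lemma compact_sector: "compact sector"
proof -
  let ?f = "\<lambda>p. fst p *\<^sub>R v + snd p *\<^sub>R w"
  have f: "continuous_on UNIV ?f" by (intro continuous_intros)
  have cl: "closed {p. norm (?f p) \<le> 1}"
    by (intro closed_Collect_le continuous_intros)
  have "compact (({0..1::real} \<times> {0..1::real}) \<inter> {p. norm (?f p) \<le> 1})"
    by (intro compact_Int_closed compact_Times cl) auto
  then have "compact (?f ` (({0..1::real} \<times> {0..1::real}) \<inter> {p. norm (?f p) \<le> 1}))"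
    by (intro compact_continuous_image continuous_on_subset[OF f]) auto
  also have "?f ` (({0..1::real} \<times> {0..1::real}) \<inter> {p. norm (?f p) \<le> 1}) = sector"
  proof (intro equalityI subsetI)
    fix x assume x: "x \<in> sector"
    have "x = ?f (\<omega> x w, \<omega> v x)" using expand[of x] by simp
    moreover have "(\<omega> x w, \<omega> v x) \<in> ({0..1::real} \<times> {0..1::real}) \<inter> {p. norm (?f p) \<le> 1}"
      using x coord_v_le[of x] coord_w_le[of x] expand[of x] by (auto simp: sector_def)
    ultimately show "x \<in> ?f ` (({0..1::real} \<times> {0..1::real}) \<inter> {p. norm (?f p) \<le> 1})" by blast
  qed (auto simp: sector_def \<omega>_vw)
  finally show ?thesis .
qed

lemma convex_sector: "convex sector"
proof (rule convexI)
  fix x y :: 'a and a b :: real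
  assume xy: "x \<in> sector" "y \<in> sector" and ab: "0 \<le> a" "0 \<le> b" "a + b = 1"
  have "norm (a *\<^sub>R x + b *\<^sub>R y) \<le> a * norm x + b * norm y"
    using norm_triangle_ineq[of "a *\<^sub>R x" "b *\<^sub>R y"] ab by simp
  also have "\<dots> \<le> a * 1 + b * 1" using xy ab by (intro add_mono mult_left_mono) (auto simp: sector_def)
  finally show "a *\<^sub>R x + b *\<^sub>R y \<in> sector" using xy ab by (simp add: sector_def)
qed

text \<open>An interior point can still be moved by small multiples of \<open>- v\<close>, of
  \<open>- w\<close> and of itself, which makes the three inequalities strict.\<close>

lemma interior_sector: "interior sector = {x. 0 < \<omega> x w \<and> 0 < \<omega> v x \<and> norm x < 1}"
proof
  have "open {x. 0 < \<omega> x w \<and> 0 < \<omega> v x \<and> norm x < 1}"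
    by (intro open_Collect_conj open_Collect_less continuous_intros)
  then show "{x. 0 < \<omega> x w \<and> 0 < \<omega> v x \<and> norm x < 1} \<subseteq> interior sector"
    by (intro interior_maximal) (auto simp: sector_def)
next
  show "interior sector \<subseteq> {x. 0 < \<omega> x w \<and> 0 < \<omega> v x \<and> norm x < 1}"
  proof
    fix x assume "x \<in> interior sector"
    then obtain r where r: "r > 0" "cball x r \<subseteq> sector" unfolding mem_interior_cball by blast
    have near: "x + d \<in> sector" if "norm d \<le> r" for d
      using r that by (auto simp: dist_norm)
    have A: "0 < \<omega> x w" using near[of "- r *\<^sub>R v"] r by (auto simp: sector_def norm_v \<omega>_vw)
    moreover have "0 < \<omega> v x" using near[of "- r *\<^sub>R w"] r by (auto simp: sector_def norm_w \<omega>_vw)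
    moreover have "norm x < 1"
    proof -
      have x0: "norm x > 0" using A by auto
      have "x + (r / norm x) *\<^sub>R x \<in> sector" using x0 r by (intro near) simp
      then have "norm ((1 + r / norm x) *\<^sub>R x) \<le> 1" by (simp add: sector_def algebra_simps)
      moreover have "norm ((1 + r / norm x) *\<^sub>R x) = norm x + r"
        using x0 r by (simp only: norm_scaleR) (simp add: field_simps)
      ultimately show ?thesis using r by simp
    qed
    ultimately show "x \<in> {x. 0 < \<omega> x w \<and> 0 < \<omega> v x \<and> norm x < 1}" by blast
  qed
qed

lemma frontier_sector: "quarter \<union> closed_segment 0 v \<union> closed_segment 0 w = frontier sector"
proof -
  have "frontier sector = sector - {x. 0 < \<omega> x w \<and> 0 < \<omega> v x \<and> norm x < 1}"
    unfolding frontier_def interior_sector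
    using closure_closed[OF compact_imp_closed[OF compact_sector]] by simp
  also have "\<dots> = quarter \<union> closed_segment 0 v \<union> closed_segment 0 w"
  proof (intro equalityI subsetI)
    fix x assume "x \<in> sector - {x. 0 < \<omega> x w \<and> 0 < \<omega> v x \<and> norm x < 1}"
    then have x: "0 \<le> \<omega> x w" "0 \<le> \<omega> v x" "norm x \<le> 1"
      and "\<omega> x w = 0 \<or> \<omega> v x = 0 \<or> norm x = 1" by (auto simp: sector_def)
    then consider "\<omega> x w = 0" | "\<omega> v x = 0" | "norm x = 1" by blast
    then show "x \<in> quarter \<union> closed_segment 0 v \<union> closed_segment 0 w"
    proof cases
      case 1
      then have "x = \<omega> v x *\<^sub>R w" using expand[of x] by simp
      then show ?thesis using x coord_w_le[of x] unfolding closed_segment_def by force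
    next
      case 2
      then have "x = \<omega> x w *\<^sub>R v" using expand[of x] by simp
      then show ?thesis using x coord_v_le[of x] unfolding closed_segment_def by force
    next
      case 3
      then show ?thesis using x by (auto simp: quarter_def)
    qed
  qed (auto simp: quarter_def sector_def closed_segment_def norm_v norm_w \<omega>_vw)
  finally show ?thesis by simp
qed

lemma convex_body_sector: "convex_body sector"
proof -
  have "(1 / 4) *\<^sub>R v + (1 / 4) *\<^sub>R w \<in> interior sector"
    using norm_triangle_ineq[of "(1 / 4) *\<^sub>R v" "(1 / 4) *\<^sub>R w"]
    by (auto simp: interior_sector \<omega>_vw norm_v norm_w)
  then show ?thesis using compact_sector convex_sector by (auto simp: convex_body_def)
qed

lemma quarter_subset_parallelogram: "quarter \<subseteq> convex hull {0, v, w, v + w}"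
proof
  fix x assume "x \<in> quarter"
  then have a: "0 \<le> \<omega> x w" "\<omega> x w \<le> 1" and b: "0 \<le> \<omega> v x" "\<omega> v x \<le> 1"
    using coord_v_le[of x] coord_w_le[of x] by (auto simp: quarter_def)
  let ?H = "convex hull {0, v, w, v + w}"
  have H: "0 \<in> ?H" "v \<in> ?H" "w \<in> ?H" "v + w \<in> ?H" by (auto intro: hull_inc)
  have comb: "(1 - t) *\<^sub>R p + t *\<^sub>R q \<in> ?H" if "p \<in> ?H" "q \<in> ?H" "0 \<le> t" "t \<le> 1" for p q t
    using that by (intro convexD convex_convex_hull) auto
  \<comment> \<open>Bilinear interpolation of the four vertices, with the coordinates of
    \<open>x\<close> as weights.\<close>
  have "(1 - \<omega> v x) *\<^sub>R ((1 - \<omega> x w) *\<^sub>R 0 + \<omega> x w *\<^sub>R v)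
      + \<omega> v x *\<^sub>R ((1 - \<omega> x w) *\<^sub>R w + \<omega> x w *\<^sub>R (v + w)) \<in> ?H"
    using a b H by (intro comb)
  also have "(1 - \<omega> v x) *\<^sub>R ((1 - \<omega> x w) *\<^sub>R 0 + \<omega> x w *\<^sub>R v)
      + \<omega> v x *\<^sub>R ((1 - \<omega> x w) *\<^sub>R w + \<omega> x w *\<^sub>R (v + w)) = x"
    by (rule coord_eqI) (auto simp: \<omega>_vw algebra_simps)
  finally show "x \<in> ?H" .
qed

text \<open>With the quarter as first arc, \<open>SUP_quarter_eq_norm\<close> turns
  \<open>radon_gamma2\<close> into the radial projection of the chord from \<open>w\<close> to
  \<open>- v\<close>, that is, the quarter path of the rotated frame.\<close>

lemma radon_curve_if_birkhoff_symmetric: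
  assumes sym: "\<And>x y :: 'a. x \<stileturn>\<^sub>B y \<Longrightarrow> y \<stileturn>\<^sub>B x"
  shows "radon_curve {x :: 'a. norm x = 1}"
proof -
  let ?Q2 = "{y. norm y = 1 \<and> \<omega> y w \<le> 0 \<and> 0 \<le> \<omega> v y}"
  have gamma2: "radon_gamma2 \<omega> v w quarter l = (1 / norm y) *\<^sub>R y"
    if "l \<in> {0..1}" "y = (1 - l) *\<^sub>R w + l *\<^sub>R (- v)" for l y
  proof -
    have "(SUP x\<in>quarter. \<bar>\<omega> x y\<bar>) = norm y"
      using that by (intro SUP_quarter_eq_norm[OF sym]) (auto simp: \<omega>_vw)
    then show ?thesis using that(2) by (simp add: radon_gamma2_def Let_def del: \<omega>_simps)
  qed
  have image: "radon_gamma2 \<omega> v w quarter ` {0..1} = ?Q2"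
  proof -
    have "radon_gamma2 \<omega> v w quarter l = unit_frame.quarter_path w (- v) l" if "l \<in> {0..1}" for l
      using gamma2[OF that refl]
      by (simp add: unit_frame.quarter_path_def[OF rotated] unit_frame.chord_def[OF rotated])
    then have "radon_gamma2 \<omega> v w quarter ` {0..1} = unit_frame.quarter_path w (- v) ` {0..1}"
      by (intro image_cong) auto
    then show ?thesis using unit_frame.quarter_path_image[OF rotated] next_quarter by simp
  qed
  have ind: "v \<noteq> w" "independent {v, w}"
  proof -
    show "v \<noteq> w" using \<omega>_vw by auto
    have "v \<noteq> c *\<^sub>R w" for c using \<omega>_vw by auto
    moreover have "w \<noteq> 0" using norm_w by auto
    ultimately show "independent {v, w}"
      by (auto simp: independent_insert span_singleton)
  qed
  have union: "{x :: 'a. norm x = 1} = quarter \<union> ?Q2 \<union> uminus ` quarter \<union> uminus ` ?Q2" (is "_ = ?R")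
  proof (intro equalityI subsetI)
    fix x :: 'a assume "x \<in> {x. norm x = 1}"
    then have n: "norm x = 1" by simp
    have neg: "x \<in> uminus ` T" if "- x \<in> T" for T using that by (intro image_eqI[of _ _ "- x"]) auto
    consider "0 \<le> \<omega> x w" "0 \<le> \<omega> v x" | "\<omega> x w \<le> 0" "0 \<le> \<omega> v x"
      | "\<omega> x w \<le> 0" "\<omega> v x \<le> 0" | "0 \<le> \<omega> x w" "\<omega> v x \<le> 0" by linarith
    then show "x \<in> ?R"
    proof cases
      case 3
      then have "- x \<in> quarter" using n by (simp add: quarter_def)
      then show ?thesis using neg by blast
    next
      case 4
      then have "- x \<in> ?Q2" using n by simp
      then show ?thesis using neg by blast
    qed (use n in \<open>auto simp: quarter_def\<close>)
  qed (auto simp: quarter_def)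
  show ?thesis unfolding radon_curve_def
  proof (intro exI conjI)
    show "v \<noteq> w" "independent {v, w}" by (rule ind)+
    show "symplectic_form \<omega>" by (rule symplectic)
    show "\<omega> v w = 1" by (rule \<omega>_vw)
    show "arc quarter_path" by (rule arc_quarter_path)
    show "pathstart quarter_path = v" "pathfinish quarter_path = w"
      unfolding pathstart_def pathfinish_def by (rule quarter_path_0 quarter_path_1)+
    show "path_image quarter_path = quarter" unfolding path_image_def by (rule quarter_path_image)
    show "quarter \<subseteq> convex hull {0, v, w, v + w}" by (rule quarter_subset_parallelogram)
    show "convex_body sector" by (rule convex_body_sector)
    show "quarter \<union> closed_segment 0 v \<union> closed_segment 0 w = frontier sector"
      by (rule frontier_sector)
    show "?Q2 = radon_gamma2 \<omega> v w quarter ` {0..1}" by (rule image[symmetric])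
    show "{x. norm x = 1} = quarter \<union> ?Q2 \<union> uminus ` quarter \<union> uminus ` ?Q2" by (rule union)
  qed
qed

end

section \<open>From a given Radon curve to a unit frame\<close>

text \<open>The basis of the construction is shown to be a unit frame and its first arc to be
  exactly the quarter, so that \<open>birkhoff_symmetric_if_gamma2_unit\<close> applies.\<close>

lemma birkhoff_symmetric_if_radon_curve:
  fixes x y :: "'a::real_normed_vector"
  assumes plane: "dim (UNIV :: 'a set) = 2" and radon: "radon_curve {x :: 'a. norm x = 1}"
    and orth: "x \<stileturn>\<^sub>B y"
  shows "y \<stileturn>\<^sub>B x"
proof -
  obtain v w :: 'a and \<omega> \<gamma>\<^sub>1 g where ne: "v \<noteq> w" and ind: "independent {v, w}"
    and symp: "symplectic_form \<omega>" and one: "\<omega> v w = 1"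
    and g: "pathstart g = v" "pathfinish g = w" "path_image g = \<gamma>\<^sub>1"
    and hull: "\<gamma>\<^sub>1 \<subseteq> convex hull {0, v, w, v + w}"
    and S: "{x. norm x = 1} = \<gamma>\<^sub>1 \<union> radon_gamma2 \<omega> v w \<gamma>\<^sub>1 ` {0..1} \<union> uminus ` \<gamma>\<^sub>1
      \<union> uminus ` radon_gamma2 \<omega> v w \<gamma>\<^sub>1 ` {0..1}"
    using radon unfolding radon_curve_def by blast
  interpret symplectic_frame \<omega> v w
    using symp one span_pair_eq_UNIV[OF plane ind ne] by (rule symplectic_frameI)
  have vw: "v \<in> \<gamma>\<^sub>1" "w \<in> \<gamma>\<^sub>1" using g pathstart_in_path_image pathfinish_in_path_image by metis+
  have sub: "\<gamma>\<^sub>1 \<subseteq> {x. norm x = 1}" "radon_gamma2 \<omega> v w \<gamma>\<^sub>1 ` {0..1} \<subseteq> {x. norm x = 1}"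
    using S by auto
  have cases: "x \<in> \<gamma>\<^sub>1 \<or> - x \<in> \<gamma>\<^sub>1 \<or> (\<exists>l\<in>{0..1}. x = radon_gamma2 \<omega> v w \<gamma>\<^sub>1 l)
      \<or> (\<exists>l\<in>{0..1}. - x = radon_gamma2 \<omega> v w \<gamma>\<^sub>1 l)" if "norm x = 1" for x
    using that S by (smt (verit) UnE imageE mem_Collect_eq minus_minus)
  have box: "0 \<le> \<omega> x w \<and> \<omega> x w \<le> 1 \<and> 0 \<le> \<omega> v x \<and> \<omega> v x \<le> 1" if "x \<in> \<gamma>\<^sub>1" for x
  proof -
    let ?P = "{x. 0 \<le> \<omega> x w \<and> \<omega> x w \<le> 1 \<and> 0 \<le> \<omega> v x \<and> \<omega> v x \<le> 1}"
    have "convex ?P" by (rule convexI) (auto intro!: convex_bound_le)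
    then have "convex hull {0, v, w, v + w} \<subseteq> ?P"
      by (intro hull_minimal) (auto simp: \<omega>_vw)
    then show ?thesis using that hull by blast
  qed
  \<comment> \<open>The witness is the supremum in the construction. The parallelogram bounds the
    areas, so it is a genuine supremum; since \<open>v\<close> and \<open>w\<close> lie on the arc,
    it is at least \<open>1 - l\<close> and \<open>l\<close>, hence positive.\<close>
  have gamma2: "\<exists>m>0. 1 - l \<le> m \<and> l \<le> m \<and> \<omega> (radon_gamma2 \<omega> v w \<gamma>\<^sub>1 l) w = - l / m
      \<and> \<omega> v (radon_gamma2 \<omega> v w \<gamma>\<^sub>1 l) = (1 - l) / m" if l: "l \<in> {0..1}" for l
  proof -
    define u where "u = (1 - l) *\<^sub>R w + l *\<^sub>R (- v)"
    define m where "m = (SUP x\<in>\<gamma>\<^sub>1. \<bar>\<omega> x u\<bar>)"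
    have u: "\<omega> u w = - l" "\<omega> v u = 1 - l" by (auto simp: u_def \<omega>_vw)
    have "\<bar>\<omega> x u\<bar> \<le> 2" if "x \<in> \<gamma>\<^sub>1" for x
    proof -
      have "\<omega> x u = \<omega> x w * (1 - l) + \<omega> v x * l" using \<omega>_coord[of x u] u by simp
      moreover have "0 \<le> \<omega> x w * (1 - l)" "\<omega> x w * (1 - l) \<le> 1" "0 \<le> \<omega> v x * l" "\<omega> v x * l \<le> 1"
        using box[OF that] l by (auto intro: mult_le_one)
      ultimately show ?thesis by simp
    qed
    then have bdd: "bdd_above ((\<lambda>x. \<bar>\<omega> x u\<bar>) ` \<gamma>\<^sub>1)" by (rule bdd_aboveI2)
    have "\<bar>\<omega> v u\<bar> \<le> m" "\<bar>\<omega> w u\<bar> \<le> m" unfolding m_def by (intro cSUP_upper vw bdd)+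
    then have m: "1 - l \<le> m" "l \<le> m" using u \<omega>_flip[of w u] by auto
    have eq: "radon_gamma2 \<omega> v w \<gamma>\<^sub>1 l = (1 / m) *\<^sub>R u"
      by (simp add: radon_gamma2_def Let_def m_def u_def del: \<omega>_simps)
    show ?thesis by (intro exI[of _ m]) (use m u eq in auto)
  qed
  have coords: "\<bar>\<omega> x w\<bar> \<le> 1 \<and> \<bar>\<omega> v x\<bar> \<le> 1" if "norm x = 1" for x
  proof -
    have *: "\<bar>\<omega> y w\<bar> \<le> 1 \<and> \<bar>\<omega> v y\<bar> \<le> 1" if l: "l \<in> {0..1}" and y: "y = radon_gamma2 \<omega> v w \<gamma>\<^sub>1 l" for y l
    proof -
      obtain m where "m > 0" "1 - l \<le> m" "l \<le> m" "\<omega> y w = - l / m" "\<omega> v y = (1 - l) / m"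
        using gamma2[OF l] y by blast
      then show ?thesis using l by simp
    qed
    consider "x \<in> \<gamma>\<^sub>1" | "- x \<in> \<gamma>\<^sub>1" | l where "l \<in> {0..1}" "x = radon_gamma2 \<omega> v w \<gamma>\<^sub>1 l"
      | l where "l \<in> {0..1}" "- x = radon_gamma2 \<omega> v w \<gamma>\<^sub>1 l"
      using cases[OF \<open>norm x = 1\<close>] by blast
    then show ?thesis
    proof cases
      case 1
      then show ?thesis using box[of x] by simp
    next
      case 2
      then show ?thesis using box[of "- x"] by simp
    next
      case 3
      then show ?thesis by (rule *)
    next
      case 4
      show ?thesis using *[OF 4] by simp
    qed
  qed
  have scaled: "\<bar>\<omega> x w\<bar> \<le> norm x \<and> \<bar>\<omega> v x\<bar> \<le> norm x" for x
  proof (cases "x = 0")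
    case False
    then show ?thesis using coords[of "(1 / norm x) *\<^sub>R x"] by simp
  qed auto
  interpret unit_frame \<omega> v w
  proof
    show "norm v = 1" "norm w = 1" using vw sub(1) by blast+
  qed (use scaled in blast)+
  \<comment> \<open>Points of the other three arcs that fall into the first quadrant lie on a
    coordinate axis, hence are \<open>v\<close> or \<open>w\<close>.\<close>
  have "x \<in> \<gamma>\<^sub>1" if x: "x \<in> quarter" for x
  proof -
    have n: "norm x = 1" "0 \<le> \<omega> x w" "0 \<le> \<omega> v x" using x by (auto simp: quarter_def)
    have xv: "x = v" if "\<omega> v x = 0"
    proof -
      have eq: "x = \<omega> x w *\<^sub>R v" using expand[of x] that by simp
      have "norm x = \<bar>\<omega> x w\<bar> * norm v" by (subst eq) (rule norm_scaleR)
      then have "\<omega> x w = 1" using n norm_v by simp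
      then show ?thesis using eq by simp
    qed
    have xw: "x = w" if "\<omega> x w = 0"
    proof -
      have eq: "x = \<omega> v x *\<^sub>R w" using expand[of x] that by simp
      have "norm x = \<bar>\<omega> v x\<bar> * norm w" by (subst eq) (rule norm_scaleR)
      then have "\<omega> v x = 1" using n norm_w by simp
      then show ?thesis using eq by simp
    qed
    consider "x \<in> \<gamma>\<^sub>1" | "- x \<in> \<gamma>\<^sub>1" | l where "l \<in> {0..1}" "x = radon_gamma2 \<omega> v w \<gamma>\<^sub>1 l"
      | l where "l \<in> {0..1}" "- x = radon_gamma2 \<omega> v w \<gamma>\<^sub>1 l"
      using cases[OF n(1)] by blast
    then show ?thesis
    proof cases
      case 2
      then have "\<omega> x w = 0" "\<omega> v x = 0" using box[of "- x"] n by auto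
      then show ?thesis using xv vw by auto
    next
      case 3
      then obtain m where "m > 0" "\<omega> x w = - l / m" using gamma2 by metis
      then have "\<omega> x w \<le> 0" using 3 by (simp add: divide_nonpos_pos)
      then show ?thesis using n xw vw by auto
    next
      case 4
      then obtain m where m: "m > 0" "\<omega> v (- x) = (1 - l) / m" using gamma2 by metis
      have "0 \<le> \<omega> v (- x)" using m(1) 4(1) unfolding m(2) by simp
      then have "\<omega> v x \<le> 0" by simp
      then show ?thesis using n xv vw by auto
    qed
  qed
  then have "quarter \<subseteq> \<gamma>\<^sub>1" by blast
  moreover have "\<gamma>\<^sub>1 \<subseteq> quarter" using box sub(1) unfolding quarter_def by blast
  ultimately have quarter: "quarter = \<gamma>\<^sub>1" by (rule equalityI)
  have "norm (radon_gamma2 \<omega> v w quarter l) = 1" if "l \<in> {0..1}" for l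
    using sub(2) that unfolding quarter by blast
  then show ?thesis using orth by (rule birkhoff_symmetric_if_gamma2_unit)
qed

text \<open>A normalized orthogonal pair gives the bound on one coordinate; symmetry of
  orthogonality gives the bound on the other.\<close>

lemma unit_frame_exists:
  assumes plane: "dim (UNIV :: 'a::real_normed_vector set) = 2"
    and sym: "\<And>x y :: 'a. x \<stileturn>\<^sub>B y \<Longrightarrow> y \<stileturn>\<^sub>B x"
  obtains \<omega> and v w :: "'a::real_normed_vector" where "unit_frame \<omega> v w"
proof -
  obtain B :: "'a set" where B: "independent B" "card B = 2"
    using plane basis_exists[of "UNIV :: 'a set"] by metis
  then obtain e w\<^sub>0 where e: "B = {e, w\<^sub>0}" "e \<noteq> w\<^sub>0" by (auto simp: card_2_iff)
  have w0: "w\<^sub>0 \<noteq> 0" using B e dependent_zero by blast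
  obtain t where orth: "(e + t *\<^sub>R w\<^sub>0) \<stileturn>\<^sub>B w\<^sub>0" using birkhoff_orthogonal_exists_left[OF w0] .
  have e_notin: "e \<noteq> c *\<^sub>R w\<^sub>0" for c
  proof
    assume "e = c *\<^sub>R w\<^sub>0"
    then have "e \<in> span {w\<^sub>0}" by (simp add: span_base span_scale)
    then show False using B e by (auto simp: independent_insert)
  qed
  define p where "p = e + t *\<^sub>R w\<^sub>0"
  have p_notin: "p \<noteq> c *\<^sub>R w\<^sub>0" for c
    using e_notin[of "c - t"] by (auto simp: p_def algebra_simps eq_diff_eq)
  then have p0: "p \<noteq> 0" by (metis scaleR_zero_left)
  define v w where "v = (1 / norm p) *\<^sub>R p" and "w = (1 / norm w\<^sub>0) *\<^sub>R w\<^sub>0"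
  have nv: "norm v = 1" and nw: "norm w = 1" using p0 w0 by (auto simp: v_def w_def)
  have v_notin: "v \<noteq> c *\<^sub>R w" for c
  proof
    assume "v = c *\<^sub>R w"
    then have "norm p *\<^sub>R v = (norm p * c) *\<^sub>R w" by simp
    then have "p = (norm p * c / norm w\<^sub>0) *\<^sub>R w\<^sub>0" using p0 by (simp add: v_def w_def)
    then show False using p_notin by blast
  qed
  have ind: "independent {v, w}" and ne: "v \<noteq> w"
    using v_notin[of 1] v_notin nw by (auto simp: independent_insert span_singleton)
  have vw: "v \<stileturn>\<^sub>B w" unfolding birkhoff_orthogonal_def
  proof
    fix s
    have "norm p \<le> norm (p + (norm p * s / norm w\<^sub>0) *\<^sub>R w\<^sub>0)"
      using orth unfolding birkhoff_orthogonal_def p_def by blast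
    also have "p + (norm p * s / norm w\<^sub>0) *\<^sub>R w\<^sub>0 = norm p *\<^sub>R (v + s *\<^sub>R w)"
      using p0 by (simp add: v_def w_def scaleR_add_right)
    finally show "norm v \<le> norm (v + s *\<^sub>R w)" using p0 nv by simp
  qed
  note sp = span_pair_eq_UNIV[OF plane ind ne]
  obtain \<omega> where \<omega>: "symplectic_form \<omega>" "\<omega> v w = 1" using symplectic_form_exists[OF ind ne sp] .
  interpret symplectic_frame \<omega> v w using \<omega> sp by (rule symplectic_frameI)
  have "unit_frame \<omega> v w"
  proof
    show "\<bar>\<omega> x w\<bar> \<le> norm x" for x
      using vw unfolding birkhoff_orthogonal_iff by (simp add: nv \<omega>)
    have "\<bar>\<omega> x v\<bar> \<le> norm x" for x
      using sym[OF vw] unfolding birkhoff_orthogonal_iff by (simp add: nw \<omega>_wv)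
    then show "\<bar>\<omega> v x\<bar> \<le> norm x" for x using \<omega>_flip[of x v] by (metis abs_minus_cancel)
  qed (rule nv nw)+
  then show thesis by (rule that)
qed

theorem theorem4p1:
  assumes plane: "dim (UNIV :: 'a::real_normed_vector set) = 2"
  shows "(\<forall>x y :: 'a. x \<stileturn>\<^sub>B y \<longrightarrow> y \<stileturn>\<^sub>B x) \<longleftrightarrow> radon_curve {x :: 'a. norm x = 1}"
proof
  assume sym: "\<forall>x y :: 'a. x \<stileturn>\<^sub>B y \<longrightarrow> y \<stileturn>\<^sub>B x"
  obtain \<omega> and v w :: 'a where "unit_frame \<omega> v w"
    using unit_frame_exists[OF plane] sym by blast
  then show "radon_curve {x :: 'a. norm x = 1}"
    using sym by (intro unit_frame.radon_curve_if_birkhoff_symmetric) blast+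
next
  assume "radon_curve {x :: 'a. norm x = 1}"
  then show "\<forall>x y :: 'a. x \<stileturn>\<^sub>B y \<longrightarrow> y \<stileturn>\<^sub>B x"
    using birkhoff_symmetric_if_radon_curve[OF plane] by blast
qed

end
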